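(* Let $f \in C^1(\mathbb{R}^n,\mathbb{R}^n)$, and assume that the ODE $\dot{x}(t)=f(x(t))$ has a unique solution map $\phi_f:\mathbb{R}^n\times[0,\infty)\to\mathbb{R}^n$. Suppose there exist a function $V \in C^1(\mathbb{R}^n,[0,\infty))$ and a compact set $\Omega\subset\mathbb{R}^n$ such that $$\nabla V(x)^T f(x) \le -(V(x)-1)\quad \text{for all } x\in\Omega,$$ $$\{x\in\Omega : V(x)\le 1\}\subseteq \Omega^\circ,$$ $$\{x\in\Omega : V(x)\le 1\}\neq\emptyset .$$ Then $\{x\in\Omega : V(x)\le 1\}$ is an attractor set of the ODE $\dot{x}(t)=f(x(t))$.
   Context: $\Omega^\circ$ denotes the interior of $\Omega$. For $x\in\mathbb{R}^n$ and $A\subset\mathbb{R}^n$, $D(x,A)=D(A,x):=\inf_{y\in A}\|x-y\|_2$; $B(x,\eta):=\{y\in\mathbb{R}^n:\|x-y\|_2<\eta\}$ and $B(A,\eta):=\bigcup_{x\in A}B(x,\eta)$ for $\eta>0$. The solution map $\phi_f:\mathbb{R}^n\times[0,\infty)\to\mathbb{R}^n$ of the ODE satisfies $\frac{\partial}{\partial t}\phi_f(x,t)=f(\phi_f(x,t))$, $\phi_f(x,0)=x$, and $\phi_f(\phi_f(x,t),s)=\phi_f(x,t+s)$ for all $x\in\mathbb{R}^n$ and $s,t\ge 0$. Standing assumption: such a solution map exists and is unique on $\mathbb{R}^n\times[0,\infty)$. Attractor set (short for stable compact attractor set): a set $A\subset\mathbb{R}^n$ is an attractor set of the ODE $\dot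 x=f(x)$ if (1) $A$ is compact and nonempty; (2) $\phi_f(x,t)\in A$ for all $x\in A$ and $t\ge 0$; (3) for all $x\in A$ there exists $\delta>0$ such that for any $\varepsilon>0$ there exists $T\ge0$ for which $D(\phi_f(y,t),A)<\varepsilon$ for all $y\in B(x,\delta)$ and $t\ge T$; (4) for all $\varepsilon>0$ there exists $\delta>0$ such that $x\in B(A,\delta)$ implies $D(A,\phi_f(x,t))<\varepsilon$ for all $t\ge 0$. *)

theory Defs
  imports "HOL-Analysis.Analysis"
begin

text \<open>\<open>C\<^sup>1\<close> on the whole space: the Frechet derivative exists everywhere and is continuous
  with respect to the operator norm.\<close>

definition C1 :: "('a::real_normed_vector \<Rightarrow> 'b::real_normed_vector) \<Rightarrow> bool" where
  "C1 f \<longleftrightarrow> (\<exists>f' :: 'a \<Rightarrow> 'a \<Rightarrow>\<^sub>L 'b.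
     (\<forall>x. (f has_derivative blinfun_apply (f' x)) (at x)) \<and> continuous_on UNIV f')"

definition gradient :: "('a::euclidean_space \<Rightarrow> real) \<Rightarrow> 'a \<Rightarrow> 'a" where
  "gradient V x = (THE D. GDERIV V x :> D)"

lemma gradient_eqI:
  fixes V :: "'a::euclidean_space \<Rightarrow> real"
  assumes "GDERIV V x :> D"
  shows "gradient V x = D"
  unfolding gradient_def
proof (rule the_equality)
  fix D' assume "GDERIV V x :> D'"
  then have "(\<lambda>h. h \<bullet> D') = (\<lambda>h. h \<bullet> D)"
    using assms unfolding gderiv_def by (rule has_derivative_unique)
  then show "D' = D"
    by (metis vector_eq_ldot)
qed (rule assms)

lemma GDERIV_gradient:
  fixes V :: "'a::euclidean_space \<Rightarrow> real"
  assumes "V differentiable (at x)"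
  shows "GDERIV V x :> gradient V x"
proof -
  from assms obtain V' where V': "(V has_derivative V') (at x)"
    unfolding differentiable_def by blast
  then have "V' = (\<lambda>h. h \<bullet> adjoint V' 1)"
    using adjoint_works[OF has_derivative_linear[OF V'], of _ 1] by auto
  with V' have "GDERIV V x :> adjoint V' 1"
    unfolding gderiv_def by metis
  then show ?thesis
    using gradient_eqI by metis
qed

text \<open>Time ranges over \<open>[0, \<infinity>)\<close>; values of \<open>\<phi>\<close> at negative times are irrelevant, and the
  time derivative at \<open>0\<close> is one-sided.\<close>

definition is_solution_map ::
    "('a::euclidean_space \<Rightarrow> 'a) \<Rightarrow> ('a \<Rightarrow> real \<Rightarrow> 'a) \<Rightarrow> bool" where
  "is_solution_map f \<phi> \<longleftrightarrow>
     (\<forall>x. \<forall>t\<ge>0. (\<phi> x has_vector_derivative f (\<phi> x t)) (at t within {0..})) \<and>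
     (\<forall>x. \<phi> x 0 = x) \<and>
     (\<forall>x. \<forall>t\<ge>0. \<forall>s\<ge>0. \<phi> (\<phi> x t) s = \<phi> x (t + s))"

definition is_unique_solution_map ::
    "('a::euclidean_space \<Rightarrow> 'a) \<Rightarrow> ('a \<Rightarrow> real \<Rightarrow> 'a) \<Rightarrow> bool" where
  "is_unique_solution_map f \<phi> \<longleftrightarrow>
     is_solution_map f \<phi> \<and>
     (\<forall>\<psi>. is_solution_map f \<psi> \<longrightarrow> (\<forall>x. \<forall>t\<ge>0. \<psi> x t = \<phi> x t))"

text \<open>The ODE enters only through its solution map \<open>\<phi>\<close>. The junk value \<open>infdist x {} = 0\<close>
  plays no role, since \<open>A\<close> is required to be nonempty.\<close>

definition attractor_set ::
    "('a::euclidean_space \<Rightarrow> real \<Rightarrow> 'a) \<Rightarrow> 'a set \<Rightarrow> bool" where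
  "attractor_set \<phi> A \<longleftrightarrow>
     compact A \<and> A \<noteq> {} \<and>
     (\<forall>x\<in>A. \<forall>t\<ge>0. \<phi> x t \<in> A) \<and>
     (\<forall>x\<in>A. \<exists>\<delta>>0. \<forall>\<epsilon>>0. \<exists>T\<ge>0. \<forall>y\<in>ball x \<delta>. \<forall>t\<ge>T. infdist (\<phi> y t) A < \<epsilon>) \<and>
     (\<forall>\<epsilon>>0. \<exists>\<delta>>0. \<forall>x\<in>(\<Union>a\<in>A. ball a \<delta>). \<forall>t\<ge>0. infdist (\<phi> x t) A < \<epsilon>)"

end

theory Submission
  imports Defs
begin

text \<open>Along a solution that stays in \<open>\<Omega>\<close> the function \<open>e\<^sup>t (V - 1)\<close> is nonincreasing.
  As \<open>A = {x \<in> \<Omega>. V x \<le> 1}\<close> is compact, the sets \<open>{x \<in> \<Omega>. V x \<le> c}\<close> with \<open>c > 1\<close> shrink into any given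
  open neighbourhood of \<open>A\<close>; once such a set lies in the interior of \<open>\<Omega>\<close>, a solution starting
  in it cannot reach the boundary of \<open>\<Omega>\<close>, so it stays there and \<open>V\<close> decays exponentially to at most \<open>1\<close>.\<close>

lemma C1_imp_differentiable: "C1 f \<Longrightarrow> f differentiable (at x)"
  unfolding C1_def differentiable_def by blast

lemma C1_imp_continuous_on: "C1 f \<Longrightarrow> continuous_on S f"
  by (meson C1_imp_differentiable continuous_at_imp_continuous_on differentiable_imp_continuous_within)

lemma solution_map_continuous_on:
  assumes "is_solution_map f \<phi>"
  shows "continuous_on {0..} (\<phi> x)"
  using assms unfolding is_solution_map_def continuous_on_eq_continuous_within
  by (auto intro: has_vector_derivative_continuous)

text \<open>On the compact set \<open>\<Omega> - U\<close> the function \<open>V\<close> attains a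
  minimum, which exceeds \<open>a\<close> because no point there has \<open>V \<le> a\<close>; any
  \<open>c\<close> strictly between serves. If \<open>\<Omega> - U\<close> is empty, every
  \<open>c\<close> serves.\<close>

lemma sublevel_subset_open:
  fixes V :: "'a::t2_space \<Rightarrow> real"
  assumes "compact \<Omega>" "continuous_on \<Omega> V" "open U" "{x \<in> \<Omega>. V x \<le> a} \<subseteq> U"
  obtains c where "c > a" "{x \<in> \<Omega>. V x \<le> c} \<subseteq> U"
proof (cases "\<Omega> - U = {}")
  case True
  then show ?thesis
    using that[of "a + 1"] by auto
next
  case False
  have "compact (\<Omega> - U)" "continuous_on (\<Omega> - U) V"
    using assms by (auto intro: compact_diff continuous_on_subset)
  then obtain z where z: "z \<in> \<Omega> - U" "\<And>y. y \<in> \<Omega> - U \<Longrightarrow> V z \<le> V y"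
    using continuous_attains_inf[OF _ False] by metis
  then have "V z > a"
    using assms(4) by force
  then obtain c where "a < c" "c < V z"
    using dense by blast
  then show ?thesis
    using that[of c] z(2) by force
qed

text \<open>Multiplying by the integrating factor \<open>exp s\<close> turns the differential
  inequality into monotonicity of \<open>g\<close>. The mean value theorem evaluates
  \<open>g'\<close> only at times strictly inside \<open>{0..t}\<close>, so \<open>stay\<close> may
  exclude the endpoint \<open>t\<close>. This is what makes the bound available at a first exit
  time.\<close>

lemma decay_along_solution:
  fixes V :: "'a::euclidean_space \<Rightarrow> real"
  assumes sol: "is_solution_map f \<phi>" and "C1 V" and "t \<ge> 0"
    and decr: "\<And>x. x \<in> \<Omega> \<Longrightarrow> gradient V x \<bullet> f x \<le> - (V x - 1)"
    and stay: "\<And>s. 0 \<le> s \<Longrightarrow> s < t \<Longrightarrow> \<phi> x s \<in> \<Omega>"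
  shows "V (\<phi> x t) - 1 \<le> exp (- t) * (V x - 1)"
proof (cases "t = 0")
  case True
  then show ?thesis
    using sol by (simp add: is_solution_map_def)
next
  case False
  then have "t > 0"
    using \<open>t \<ge> 0\<close> by simp
  define g where "g s = (V (\<phi> x s) - 1) * exp s" for s
  define g' where "g' s = (gradient V (\<phi> x s) \<bullet> f (\<phi> x s) + (V (\<phi> x s) - 1)) * exp s" for s
  have "(g has_derivative (\<lambda>h. g' s * h)) (at s within {0..t})" if "s \<in> {0..t}" for s
  proof -
    have "(\<phi> x has_derivative (\<lambda>h. h *\<^sub>R f (\<phi> x s))) (at s within {0..t})"
      using sol that has_derivative_subset[of "\<phi> x" _ s "{0..}" "{0..t}"]
      unfolding is_solution_map_def has_vector_derivative_def by auto
    moreover have "(V has_derivative (\<lambda>h. h \<bullet> gradient V (\<phi> x s))) (at (\<phi> x s))"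
      using GDERIV_gradient[OF C1_imp_differentiable[OF \<open>C1 V\<close>]] unfolding gderiv_def .
    ultimately have "((\<lambda>s. V (\<phi> x s)) has_derivative (\<lambda>h. (h *\<^sub>R f (\<phi> x s)) \<bullet> gradient V (\<phi> x s)))
        (at s within {0..t})"
      by (rule has_derivative_compose)
    then show ?thesis
      unfolding g_def g'_def
      by (auto intro!: derivative_eq_intros simp: algebra_simps inner_commute)
  qed
  then obtain s where s: "s \<in> {0<..<t}" "g t - g 0 = g' s * t"
    using mvt_simple[OF \<open>t > 0\<close>, of g "\<lambda>s h. g' s * h"] by auto
  have "g' s \<le> 0"
    using decr[OF stay[of s]] s(1) unfolding g'_def by (auto intro: mult_nonpos_nonneg)
  then have "g t \<le> g 0"
    using s(2) \<open>t > 0\<close> by (smt (verit) mult_nonpos_nonneg)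
  then show ?thesis
    using sol unfolding g_def is_solution_map_def by (simp add: exp_minus field_simps)
qed

text \<open>A first-exit argument: decay up to the exit time keeps \<open>V \<le> c\<close> there,
  and \<open>int\<close> then puts the exit point back into the interior. The last bound involves
  \<open>c\<close> instead of \<open>V x\<close>, so it is uniform over the starting points.\<close>

lemma sublevel_set_invariant:
  fixes V :: "'a::euclidean_space \<Rightarrow> real"
  assumes sol: "is_solution_map f \<phi>" and "C1 V" and "closed \<Omega>" and "c \<ge> 1"
    and decr: "\<And>x. x \<in> \<Omega> \<Longrightarrow> gradient V x \<bullet> f x \<le> - (V x - 1)"
    and int: "{x \<in> \<Omega>. V x \<le> c} \<subseteq> interior \<Omega>"
    and x: "x \<in> \<Omega>" "V x \<le> c" and "t \<ge> 0"
  shows "\<phi> x t \<in> interior \<Omega>" "V (\<phi> x t) \<le> c"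
    and "V (\<phi> x t) - 1 \<le> exp (- t) * (c - 1)"
proof -
  have cont: "continuous_on {0..T} (\<phi> x)" for T
    by (rule continuous_on_subset[OF solution_map_continuous_on[OF sol]]) auto
  have decay: "V (\<phi> x T) - 1 \<le> exp (- T) * (c - 1)"
    if "T \<ge> 0" "\<And>s. 0 \<le> s \<Longrightarrow> s < T \<Longrightarrow> \<phi> x s \<in> \<Omega>" for T
  proof -
    have "V (\<phi> x T) - 1 \<le> exp (- T) * (V x - 1)"
      using sol \<open>C1 V\<close> that(1) decr that(2) by (rule decay_along_solution)
    also have "\<dots> \<le> exp (- T) * (c - 1)"
      using x(2) by (intro mult_left_mono) auto
    finally show ?thesis .
  qed
  have le: "exp (- T) * (c - 1) \<le> c - 1" if "T \<ge> 0" for T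
    using that \<open>c \<ge> 1\<close> by (intro mult_left_le_one_le) auto
  have stay: "\<phi> x T \<in> interior \<Omega>" if "T \<ge> 0" for T
  proof (rule ccontr)
    assume out: "\<phi> x T \<notin> interior \<Omega>"
    \<comment> \<open>The times up to \<open>T\<close> spent outside the open set
      \<open>interior \<Omega>\<close> form a compact set, so there is a first one,
      \<open>s\<close>.\<close>
    define K where "K = {0..T} \<inter> \<phi> x -` (- interior \<Omega>)"
    have "compact K"
      unfolding K_def compact_eq_bounded_closed
      by (auto intro!: continuous_closed_preimage cont bounded_Int)
    moreover have "T \<in> K"
      using out that by (auto simp: K_def)
    ultimately obtain s where s: "s \<in> K" "\<And>r. r \<in> K \<Longrightarrow> s \<le> r"
      using compact_attains_inf[of K] by blast
    have before: "\<phi> x r \<in> \<Omega>" if "0 \<le> r" "r < s" for r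
      using s that interior_subset unfolding K_def by force
    have "s \<noteq> 0"
      using s(1) sol x int by (auto simp: K_def is_solution_map_def)
    then have "s > 0"
      using s(1) by (auto simp: K_def)
    \<comment> \<open>Closedness of \<open>\<Omega>\<close> carries membership from the times before
      \<open>s\<close> over to \<open>s\<close> itself.\<close>
    have "\<phi> x ` closure {0..<s} \<subseteq> \<Omega>"
      using before \<open>closed \<Omega>\<close> cont[of s] \<open>s > 0\<close> by (intro image_closure_subset) auto
    then have "\<phi> x s \<in> \<Omega>"
      using \<open>s > 0\<close> by auto
    moreover have "V (\<phi> x s) \<le> c"
      using decay[OF less_imp_le[OF \<open>s > 0\<close>] before] le[of s] \<open>s > 0\<close> by simp
    ultimately show False
      using int s(1) by (auto simp: K_def)
  qed
  then show "V (\<phi> x t) - 1 \<le> exp (- t) * (c - 1)"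
    using decay[OF \<open>t \<ge> 0\<close>] interior_subset by blast
  then show "V (\<phi> x t) \<le> c"
    using le[OF \<open>t \<ge> 0\<close>] by simp
  show "\<phi> x t \<in> interior \<Omega>"
    using stay \<open>t \<ge> 0\<close> .
qed

theorem proposition5:
  fixes f :: "real ^ 'n \<Rightarrow> real ^ 'n"
    and \<phi> :: "real ^ 'n \<Rightarrow> real \<Rightarrow> real ^ 'n"
    and V :: "real ^ 'n \<Rightarrow> real"
    and \<Omega> :: "(real ^ 'n) set"
  assumes "C1 f"
    and "is_unique_solution_map f \<phi>"
    and "C1 V"
    and "\<And>x. V x \<ge> 0"
    and "compact \<Omega>"
    and "\<And>x. x \<in> \<Omega> \<Longrightarrow> gradient V x \<bullet> f x \<le> - (V x - 1)"
    and "{x \<in> \<Omega>. V x \<le> 1} \<subseteq> interior \<Omega>"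
    and "{x \<in> \<Omega>. V x \<le> 1} \<noteq> {}"
  shows "attractor_set \<phi> {x \<in> \<Omega>. V x \<le> 1}"
proof -
  define A where "A = {x \<in> \<Omega>. V x \<le> 1}"
  have sol: "is_solution_map f \<phi>"
    using assms(2) unfolding is_unique_solution_map_def by simp
  have contV: "continuous_on S V" for S
    by (rule C1_imp_continuous_on[OF assms(3)])
  have "closed \<Omega>"
    using assms(5) by (rule compact_imp_closed)
  note inv = sublevel_set_invariant[OF sol assms(3) \<open>closed \<Omega>\<close> _ assms(6)]
  have "A = \<Omega> \<inter> {x. V x \<le> 1}"
    by (auto simp: A_def)
  then have "compact A"
    using assms(5) contV by (auto intro!: compact_Int_closed closed_Collect_le)
  have open_sub: "open (interior \<Omega> \<inter> {x. V x < c})" for c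
    using contV by (intro open_Int open_interior open_Collect_less continuous_on_const)
  have A_sub: "A \<subseteq> interior \<Omega> \<inter> {x. V x < c}" if "c > 1" for c
    using assms(7) that by (auto simp: A_def)
  have open_infdist: "open {x. infdist x A < \<epsilon>}" for \<epsilon>
    by (intro open_Collect_less continuous_intros)
  have A_infdist: "A \<subseteq> {x. infdist x A < \<epsilon>}" if "\<epsilon> > 0" for \<epsilon>
    using that by auto
  \<comment> \<open>The level \<open>c0\<close> is fixed before any \<epsilon> is given: it
    determines the radius of attraction \<delta>, which must not depend on \<epsilon>.\<close>
  obtain c0 where c0: "c0 > 1" "{x \<in> \<Omega>. V x \<le> c0} \<subseteq> interior \<Omega>"
    using sublevel_subset_open[OF assms(5) contV open_interior assms(7)] by blast
  have near: "\<exists>c>1. {x \<in> \<Omega>. V x \<le> c} \<subseteq> interior \<Omega> \<inter> {x. infdist x A < \<epsilon>}" if "\<epsilon> > 0" for \<epsilon>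
  proof -
    have "{x \<in> \<Omega>. V x \<le> 1} \<subseteq> interior \<Omega> \<inter> {x. infdist x A < \<epsilon>}"
      using A_infdist[OF that] assms(7) unfolding A_def by blast
    from sublevel_subset_open[OF assms(5) contV open_Int[OF open_interior open_infdist] this]
    show ?thesis
      by blast
  qed
  \<comment> \<open>\<open>A\<close> is itself the sublevel set for \<open>c = 1\<close>, so the
    invariance lemma applies directly.\<close>
  have "\<phi> x t \<in> A" if "x \<in> A" "t \<ge> 0" for x t
    using inv(1,2)[of 1 x t] assms(7) that interior_subset unfolding A_def by auto
  moreover have "\<exists>\<delta>>0. \<forall>\<epsilon>>0. \<exists>T\<ge>0. \<forall>y\<in>ball x \<delta>. \<forall>t\<ge>T. infdist (\<phi> y t) A < \<epsilon>" if "x \<in> A" for x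
  proof -
    have "x \<in> interior \<Omega> \<inter> {x. V x < c0}"
      using A_sub[OF c0(1)] that by blast
    then obtain \<delta> where "\<delta> > 0" and \<delta>: "ball x \<delta> \<subseteq> interior \<Omega> \<inter> {x. V x < c0}"
      using open_sub open_contains_ball by meson
    have "\<exists>T\<ge>0. \<forall>y\<in>ball x \<delta>. \<forall>t\<ge>T. infdist (\<phi> y t) A < \<epsilon>" if eps: "\<epsilon> > 0" for \<epsilon>
    proof -
      obtain c where c: "c > 1" "{x \<in> \<Omega>. V x \<le> c} \<subseteq> interior \<Omega> \<inter> {x. infdist x A < \<epsilon>}"
        using near[OF eps] by blast
      \<comment> \<open>From time \<open>T\<close> on, the bound \<open>exp (- t) * (c0 - 1)\<close>
        is at most \<open>c - 1\<close>. The maximum with 0 covers \<open>c > c0\<close>, where the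
        logarithm is negative.\<close>
      define T where "T = max 0 (ln ((c0 - 1) / (c - 1)))"
      have "infdist (\<phi> y t) A < \<epsilon>" if "y \<in> ball x \<delta>" "t \<ge> T" for y t
      proof -
        have y: "y \<in> \<Omega>" "V y \<le> c0"
          using \<delta> that(1) interior_subset by fastforce+
        have "t \<ge> 0" "ln ((c0 - 1) / (c - 1)) \<le> t"
          using that(2) by (auto simp: T_def)
        then have "(c0 - 1) / (c - 1) \<le> exp t"
          using c0(1) c(1) by (metis divide_pos_pos diff_gt_0_iff_gt exp_le_cancel_iff exp_ln)
        then have "exp (- t) * (c0 - 1) \<le> c - 1"
          using c(1) by (simp add: exp_minus field_simps)
        then have "V (\<phi> y t) \<le> c"
          using inv(3)[OF _ _ c0(2) y \<open>t \<ge> 0\<close>] c0(1) by simp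
        moreover have "\<phi> y t \<in> \<Omega>"
          using inv(1)[OF _ _ c0(2) y \<open>t \<ge> 0\<close>] c0(1) interior_subset by auto
        ultimately show ?thesis
          using c(2) by blast
      qed
      then show ?thesis
        by (intro exI[of _ T]) (auto simp: T_def)
    qed
    then show ?thesis
      using \<open>\<delta> > 0\<close> by blast
  qed
  moreover have "\<exists>\<delta>>0. \<forall>x\<in>(\<Union>a\<in>A. ball a \<delta>). \<forall>t\<ge>0. infdist (\<phi> x t) A < \<epsilon>" if eps: "\<epsilon> > 0" for \<epsilon>
  proof -
    obtain c where c: "c > 1" "{x \<in> \<Omega>. V x \<le> c} \<subseteq> interior \<Omega> \<inter> {x. infdist x A < \<epsilon>}"
      using near[OF eps] by blast
    then have c_int: "{x \<in> \<Omega>. V x \<le> c} \<subseteq> interior \<Omega>"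
      by blast
    \<comment> \<open>Compactness of \<open>A\<close> gives one radius for all its points; the
      neighbourhood then lies in the \<open>c\<close>-sublevel set, which traps solutions within
      distance \<epsilon> of \<open>A\<close>.\<close>
    obtain \<delta> where "\<delta> > 0" and \<delta>: "(\<Union>a\<in>A. ball a \<delta>) \<subseteq> interior \<Omega> \<inter> {x. V x < c}"
      using compact_subset_open_imp_ball_epsilon_subset[OF \<open>compact A\<close> open_sub A_sub[OF c(1)]]
      by blast
    have "infdist (\<phi> x t) A < \<epsilon>" if "x \<in> (\<Union>a\<in>A. ball a \<delta>)" "t \<ge> 0" for x t
    proof -
      have x: "x \<in> \<Omega>" "V x \<le> c"
        using \<delta> that(1) interior_subset by fastforce+
      have "\<phi> x t \<in> \<Omega>" "V (\<phi> x t) \<le> c"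
        using inv(1,2)[OF _ _ c_int x that(2)] c(1) interior_subset by auto
      then show ?thesis
        using c(2) by blast
    qed
    then show ?thesis
      using \<open>\<delta> > 0\<close> by blast
  qed
  ultimately show ?thesis
    using \<open>compact A\<close> assms(8) unfolding attractor_set_def A_def by blast
qed

end
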